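(* Let $D$ be a finite tournament with vertex set $V$ and let $W_0\subseteq V$ be a set inducing an acyclic subdigraph of $D$. Then there are $W\supseteq W_0$ and $\mathcal C\in\mathrm{rs}(D)$ such that both $W$ and $V\setminus W$ induce acyclic subdigraphs of $D^{\mathcal C}$.
   Context: A tournament is a digraph (no loops) in which for all distinct $u,v$ exactly one of $uv$, $vu$ is an arc. A set of vertices is acyclic if the induced subdigraph contains no directed cycle. For a directed cycle $C$, $D^{C}$ is the digraph on $V(D)$ with arc set $(A(D)\setminus A(C))\cup\{vu: uv\in A(C)\}$. For finite $D$, $\mathrm{rs}(D)$ is the set of finite sequences $\langle C_0,\dots,C_{k-1}\rangle$ such that each $C_i$ is a directed cycle of $D^{\langle C_0,\dots,C_{i-1}\rangle}$, where $D^{\emptyset}=D$ and $D^{\mathcal C^\frown\langle C\rangle}=(D^{\mathcal C})^{C}$. *)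

theory Defs
  imports "Graph_Theory.Graph_Theory"
begin

locale tournament = pair_loopfree_digraph +
  assumes exactly_one_arc:
    "u \<in> pverts G \<Longrightarrow> v \<in> pverts G \<Longrightarrow> u \<noteq> v \<Longrightarrow>
      ((u, v) \<in> parcs G) \<noteq> ((v, u) \<in> parcs G)"

text \<open>A directed cycle is given by the list of its arcs in cyclic order, starting anywhere.\<close>

abbreviation dicycle :: "'a pair_pre_digraph \<Rightarrow> ('a \<times> 'a) list \<Rightarrow> bool" where
  "dicycle D C \<equiv> pre_digraph.cycle (with_proj D) C"

definition induces_acyclic :: "'a pair_pre_digraph \<Rightarrow> 'a set \<Rightarrow> bool" where
  "induces_acyclic D W \<longleftrightarrow> (\<nexists>C. pre_digraph.cycle (induce_subgraph (with_proj D) W) C)"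

definition reverse_cycle :: "'a pair_pre_digraph \<Rightarrow> ('a \<times> 'a) list \<Rightarrow> 'a pair_pre_digraph" where
  "reverse_cycle D C =
    \<lparr>pverts = pverts D, parcs = (parcs D - set C) \<union> {(v, u) | u v. (u, v) \<in> set C}\<rparr>"

definition reverse_cycles ::
    "'a pair_pre_digraph \<Rightarrow> ('a \<times> 'a) list list \<Rightarrow> 'a pair_pre_digraph" where
  "reverse_cycles D Cs = foldl reverse_cycle D Cs"

definition rs :: "'a pair_pre_digraph \<Rightarrow> ('a \<times> 'a) list list set" where
  "rs D = {Cs. \<forall>i < length Cs. dicycle (reverse_cycles D (take i Cs)) (Cs ! i)}"

end

theory Submission
  imports Defs
begin

text \<open>
  Among all pairs of a reversal sequence and an acyclic \<open>W \<supseteq> W\<^sub>0\<close> take one with \<open>W\<close> of maximal size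
  and then with the sum of the squared scores inside \<open>U = V - W\<close> maximal. If \<open>U\<close> is not
  transitive, two of its vertices \<open>x \<rightarrow> y\<close> have the same score inside \<open>U\<close>, so that
  \<open>y \<rightarrow> v \<rightarrow> x\<close> for some \<open>v \<in> U\<close>. If some \<open>w \<in> W\<close> distinguishes \<open>x\<close> from \<open>y\<close>, reverse the
  cycle \<open>x y w\<close> or the cycle \<open>y v x w\<close>. Otherwise, since \<open>W \<union> {x}\<close> is not acyclic,
  there are consecutive \<open>a \<rightarrow> b\<close> in \<open>W\<close> with \<open>x \<rightarrow> a\<close> and \<open>b \<rightarrow> x\<close>; reverse \<open>x y a b\<close>, which only
  swaps \<open>a\<close> and \<open>b\<close> in the order of \<open>W\<close>. Each reversal moves one unit of score between \<open>x\<close>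
  and \<open>y\<close> inside \<open>U\<close> and so increases the sum of squares.
\<close>

section \<open>Arcs, short cycles and transitivity in a tournament\<close>

lemma (in tournament) arc_in_verts: "(u, v) \<in> parcs G \<Longrightarrow> u \<in> pverts G \<and> v \<in> pverts G"
  using arc_fst_in_verts[of "(u, v)"] arc_snd_in_verts[of "(u, v)"] by simp

lemma (in tournament) arc_asym: "(u, v) \<in> parcs G \<Longrightarrow> (v, u) \<notin> parcs G"
  using arc_in_verts exactly_one_arc no_loops' by metis

lemma (in tournament) arc_total:
  "u \<in> pverts G \<Longrightarrow> v \<in> pverts G \<Longrightarrow> u \<noteq> v \<Longrightarrow> (u, v) \<in> parcs G \<or> (v, u) \<in> parcs G"
  using exactly_one_arc by blast

lemma cycle_subset_arcs:
  assumes "pre_digraph.cycle G C" shows "set C \<subseteq> arcs G"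
  using assms by (auto simp: pre_digraph.cycle_def pre_digraph.awalk_def)

lemma cycle_three:
  assumes "{(a, b), (b, c), (c, a)} \<subseteq> parcs D" "{a, b, c} \<subseteq> pverts D" "distinct [a, b, c]"
  shows "dicycle D [(a, b), (b, c), (c, a)]"
  using assms unfolding pre_digraph.cycle_def
  by (auto simp: pre_digraph.awalk_def pre_digraph.cas.simps pre_digraph.awalk_verts.simps)

lemma cycle_four:
  assumes "{(a, b), (b, c), (c, d), (d, a)} \<subseteq> parcs D" "{a, b, c, d} \<subseteq> pverts D"
    "distinct [a, b, c, d]"
  shows "dicycle D [(a, b), (b, c), (c, d), (d, a)]"
  using assms unfolding pre_digraph.cycle_def
  by (auto simp: pre_digraph.awalk_def pre_digraph.cas.simps pre_digraph.awalk_verts.simps)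

text \<open>A failure of transitivity \<open>a \<rightarrow> b \<rightarrow> c\<close> closes up to
  a directed triangle, since the arc between \<open>a\<close> and \<open>c\<close> must run from
  \<open>c\<close> to \<open>a\<close>. Conversely, a transitive arc relation on \<open>W\<close>
  equals its transitive closure, so a closed walk would produce a loop.\<close>

lemma (in tournament) induces_acyclic_iff_trans_on:
  assumes "W \<subseteq> pverts G"
  shows "induces_acyclic G W \<longleftrightarrow> trans_on W (parcs G)"
proof
  assume acyc: "induces_acyclic G W"
  show "trans_on W (parcs G)"
  proof (rule trans_onI, rule ccontr)
    fix a b c
    assume abc: "a \<in> W" "b \<in> W" "c \<in> W" "(a, b) \<in> parcs G" "(b, c) \<in> parcs G" "(a, c) \<notin> parcs G"
    then have "a \<noteq> c" "distinct [a, b, c]" using arc_asym no_loops' by auto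
    moreover from this have "(c, a) \<in> parcs G" using abc arc_total[of a c] assms by auto
    ultimately have "pre_digraph.cycle (induce_subgraph G W) [(a, b), (b, c), (c, a)]"
      using abc unfolding pre_digraph.cycle_def
      by (auto simp: pre_digraph.awalk_def pre_digraph.cas.simps pre_digraph.awalk_verts.simps
          induce_subgraph_def)
    then show False using acyc by (auto simp: induces_acyclic_def)
  qed
next
  assume tr: "trans_on W (parcs G)"
  show "induces_acyclic G W"
    unfolding induces_acyclic_def
  proof
    assume "\<exists>C. pre_digraph.cycle (induce_subgraph G W) C"
    then obtain u C where C: "pre_digraph.awalk (induce_subgraph G W) u C u" "C \<noteq> []"
      by (auto simp: pre_digraph.cycle_def)
    have "(u, u) \<in> (arcs_ends (induce_subgraph G W))\<^sup>+"
      using C wf_digraph.reachable1_awalkI[OF wellformed_induce_subgraph] by blast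
    moreover have ends: "arcs_ends (induce_subgraph G W) = parcs G \<inter> W \<times> W"
      by (auto simp: arcs_ends_def arc_to_ends_def induce_subgraph_def)
    moreover have "trans (parcs G \<inter> W \<times> W)"
      using tr by (auto simp: trans_on_def)
    ultimately have "(u, u) \<in> parcs G" by (simp add: trancl_id)
    then show False using no_loops' by blast
  qed
qed

section \<open>Reversal sequences in tournaments\<close>

lemma tournament_reverse_cycle:
  assumes "tournament D" "set C \<subseteq> parcs D"
  shows "tournament (reverse_cycle D C)"
proof -
  interpret tournament D by fact
  show ?thesis
  proof
    fix e assume "e \<in> parcs (reverse_cycle D C)"
    then show "fst e \<in> pverts (reverse_cycle D C)" "snd e \<in> pverts (reverse_cycle D C)"
      "fst e \<noteq> snd e"
      using assms(2) arc_in_verts no_loops' by (auto simp: reverse_cycle_def)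
  next
    fix u v
    assume "u \<in> pverts (reverse_cycle D C)" "v \<in> pverts (reverse_cycle D C)" "u \<noteq> v"
    then show "((u, v) \<in> parcs (reverse_cycle D C)) \<noteq> ((v, u) \<in> parcs (reverse_cycle D C))"
      using exactly_one_arc[of u v] assms(2) by (auto simp: reverse_cycle_def)
  qed
qed

lemma pverts_reverse_cycles [simp]: "pverts (reverse_cycles D Cs) = pverts D"
  by (induction Cs rule: rev_induct) (auto simp: reverse_cycles_def reverse_cycle_def)

lemma rs_snoc:
  "Cs @ [C] \<in> rs D \<longleftrightarrow> Cs \<in> rs D \<and> dicycle (reverse_cycles D Cs) C"
  by (auto simp: rs_def nth_append less_Suc_eq all_conj_distrib)

lemma reverse_cycles_snoc: "reverse_cycles D (Cs @ [C]) = reverse_cycle (reverse_cycles D Cs) C"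
  by (simp add: reverse_cycles_def)

lemma tournament_reverse_cycles:
  assumes "tournament D" "Cs \<in> rs D"
  shows "tournament (reverse_cycles D Cs)"
  using assms(2)
proof (induction Cs rule: rev_induct)
  case Nil
  then show ?case using assms(1) by (simp add: reverse_cycles_def)
next
  case (snoc C Cs)
  then show ?case
    using cycle_subset_arcs[of "with_proj (reverse_cycles D Cs)" C]
    by (simp add: rs_snoc reverse_cycles_snoc tournament_reverse_cycle)
qed

section \<open>Scores and the sum of their squares\<close>

definition score :: "'a pair_pre_digraph \<Rightarrow> 'a set \<Rightarrow> 'a \<Rightarrow> nat" where
  "score D U x = card {t \<in> U. (x, t) \<in> parcs D}"

lemma (in tournament) inj_score_imp_trans_on:
  assumes "finite U" "U \<subseteq> pverts G" "inj_on (score G U) U"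
  shows "trans_on U (parcs G)"
  using assms
proof (induction U rule: finite_psubset_induct)
  case (psubset U)
  show ?case
  proof (cases "U = {}")
    case True
    then show ?thesis by (simp add: trans_on_def)
  next
    case False
    have out: "{t \<in> U. (x, t) \<in> parcs G} \<subseteq> U - {x}" for x
      using no_loops' by auto
    \<comment> \<open>Distinct scores exhaust \<open>{..<card U}\<close>, so some vertex dominates all others; remove it.\<close>
    have "score G U x < card U" if "x \<in> U" for x
      unfolding score_def using out[of x] that psubset.hyps(1)
      by (intro psubset_card_mono) auto
    then have "score G U ` U \<subseteq> {..<card U}" by auto
    then have "score G U ` U = {..<card U}"
      using psubset.prems(2) by (simp add: card_image card_subset_eq)
    moreover have "card U > 0" using False psubset.hyps(1) by (simp add: card_gt_0_iff)
    ultimately obtain m where m: "m \<in> U" "score G U m = card U - 1"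
      by (metis diff_less imageE lessThan_iff zero_less_one)
    have "{t \<in> U. (m, t) \<in> parcs G} = U - {m}"
      using out[of m] m psubset.hyps(1) by (intro card_subset_eq) (auto simp: score_def)
    then have top: "(m, t) \<in> parcs G" if "t \<in> U" "t \<noteq> m" for t
      using that by blast
    then have no_in: "(t, m) \<notin> parcs G" if "t \<in> U" for t
      using that arc_asym no_loops' by blast
    \<comment> \<open>No arc from \<open>U\<close> enters \<open>m\<close>, so deleting
      \<open>m\<close> changes no other score and injectivity passes to the smaller set.\<close>
    have "{t \<in> U - {m}. (x, t) \<in> parcs G} = {t \<in> U. (x, t) \<in> parcs G}" if "x \<in> U" for x
      using no_in that by auto
    then have "score G (U - {m}) x = score G U x" if "x \<in> U" for x
      using that by (simp add: score_def)
    then have "inj_on (score G (U - {m})) (U - {m})"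
      using psubset.prems(2) by (auto simp: inj_on_def)
    then have "trans_on (U - {m}) (parcs G)"
      using psubset.IH[of "U - {m}"] psubset.prems(1) m(1) by auto
    then show ?thesis
      using top no_in unfolding trans_on_def by (metis DiffI singletonD)
  qed
qed

text \<open>Moving one unit between two equal entries \<open>s\<close> increases the sum of squares
  by 2, because \<open>(s - 1)\<^sup>2 + (s + 1)\<^sup>2 = 2 * s\<^sup>2 + 2\<close>.\<close>

lemma sum_squares_increase:
  fixes f g :: "'a \<Rightarrow> nat"
  assumes "finite U" "x \<in> U" "y \<in> U" "x \<noteq> y" "f x = f y" "Suc (g x) = f x" "g y = Suc (f y)"
    and "\<And>u. u \<in> U - {x, y} \<Longrightarrow> g u = f u"
  shows "(\<Sum>u\<in>U. (f u)\<^sup>2) < (\<Sum>u\<in>U. (g u)\<^sup>2)"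
proof -
  have split: "(\<Sum>u\<in>U. (h u)\<^sup>2) = (h x)\<^sup>2 + ((h y)\<^sup>2 + (\<Sum>u\<in>U - {x, y}. (h u)\<^sup>2))" for h :: "'a \<Rightarrow> nat"
  proof -
    have "U = insert x (insert y (U - {x, y}))" using assms by auto
    then have "(\<Sum>u\<in>U. (h u)\<^sup>2) = (\<Sum>u\<in>insert x (insert y (U - {x, y})). (h u)\<^sup>2)" by simp
    also have "\<dots> = (h x)\<^sup>2 + ((h y)\<^sup>2 + (\<Sum>u\<in>U - {x, y}. (h u)\<^sup>2))"
      using assms by (subst sum.insert; simp)+
    finally show ?thesis .
  qed
  have "(f x)\<^sup>2 + (f y)\<^sup>2 < (g x)\<^sup>2 + (g y)\<^sup>2"
  proof -
    have "f x = Suc (g x)" "f y = Suc (g x)" "g y = Suc (Suc (g x))" using assms(5-7) by simp_all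
    then show ?thesis by (simp add: power2_eq_square)
  qed
  moreover have "(\<Sum>u\<in>U - {x, y}. (g u)\<^sup>2) = (\<Sum>u\<in>U - {x, y}. (f u)\<^sup>2)"
    using assms(8) by simp
  ultimately show ?thesis unfolding split by simp
qed

section \<open>Cycles whose reversal increases the sum of squares\<close>

text \<open>Among the triangles \<open>x \<rightarrow> a \<rightarrow> b \<rightarrow> x\<close>
  with \<open>a\<close> and \<open>b\<close> in \<open>W\<close>, take one with the fewest vertices
  of \<open>W\<close> between \<open>a\<close> and \<open>b\<close>. A vertex \<open>t\<close>
  between them would give a better pair: \<open>(t, b)\<close> if \<open>x \<rightarrow> t\<close>,
  and \<open>(a, t)\<close> if \<open>t \<rightarrow> x\<close>.\<close>

lemma (in tournament) consecutive_cycle: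
  assumes "finite (pverts G)" "W \<subseteq> pverts G" "x \<in> pverts G - W"
    and "trans_on W (parcs G)" "\<not> trans_on (insert x W) (parcs G)"
  obtains a b where "a \<in> W" "b \<in> W" "(x, a) \<in> parcs G" "(a, b) \<in> parcs G" "(b, x) \<in> parcs G"
    "\<And>t. t \<in> W \<Longrightarrow> (a, t) \<in> parcs G \<Longrightarrow> (t, b) \<notin> parcs G"
proof -
  define P where "P = (\<lambda>(a, b). a \<in> W \<and> b \<in> W \<and> (x, a) \<in> parcs G \<and> (a, b) \<in> parcs G \<and> (b, x) \<in> parcs G)"
  define between where "between = (\<lambda>(a, b). {t \<in> W. (a, t) \<in> parcs G \<and> (t, b) \<in> parcs G})"
  have fin: "finite (between p)" for p
    using finite_subset[OF assms(2,1)] by (auto simp: between_def split: prod.splits)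
  obtain a b c where abc: "a \<in> insert x W" "b \<in> insert x W" "c \<in> insert x W"
    "(a, b) \<in> parcs G" "(b, c) \<in> parcs G" "(a, c) \<notin> parcs G"
    using assms(5) unfolding trans_on_def by blast
  then have "(c, a) \<in> parcs G"
    using arc_total[of a c] arc_asym arc_in_verts by blast
  moreover have "\<not> (a \<in> W \<and> b \<in> W \<and> c \<in> W)"
    using abc assms(4) unfolding trans_on_def by blast
  \<comment> \<open>The triangle on \<open>a\<close>, \<open>b\<close>, \<open>c\<close> passes
    through \<open>x\<close>. Rotated to start at \<open>x\<close>, its other two vertices are the
    required pair.\<close>
  ultimately have "\<exists>p. P p"
    using abc no_loops' arc_asym unfolding P_def by (auto; blast)
  then obtain p where p: "P p" "\<And>q. P q \<Longrightarrow> card (between p) \<le> card (between q)"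
    using ex_has_least_nat[of P _ "\<lambda>p. card (between p)"] by blast
  obtain a b where ab: "p = (a, b)" by fastforce
  have abW: "a \<in> W" "b \<in> W" "(x, a) \<in> parcs G" "(a, b) \<in> parcs G" "(b, x) \<in> parcs G"
    using p(1) by (auto simp: P_def ab)
  have "(t, b) \<notin> parcs G" if t: "t \<in> W" "(a, t) \<in> parcs G" for t
  proof
    assume tb: "(t, b) \<in> parcs G"
    have "(x, t) \<in> parcs G \<or> (t, x) \<in> parcs G"
      using arc_total assms(2,3) t by blast
    then obtain q where q: "P q" "q = (t, b) \<or> q = (a, t)"
      using abW t tb by (auto simp: P_def)
    have "t \<in> between p" "t \<notin> between q"
      using q(2) t tb no_loops' by (auto simp: between_def ab)
    \<comment> \<open>Transitivity of \<open>W\<close> gives the inclusion, and \<open>t\<close>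
      makes it strict.\<close>
    moreover have "between q \<subseteq> between p"
    proof
      fix s assume "s \<in> between q"
      then have s: "s \<in> W" "(a, t) \<in> parcs G \<and> (t, s) \<in> parcs G \<and> (s, b) \<in> parcs G \<or>
          (a, s) \<in> parcs G \<and> (s, t) \<in> parcs G \<and> (t, b) \<in> parcs G"
        using q(2) t tb by (auto simp: between_def)
      have "(a, s) \<in> parcs G" "(s, b) \<in> parcs G"
        using s t(1) abW(1,2) trans_onD[OF assms(4), of a t s] trans_onD[OF assms(4), of s t b] by auto
      then show "s \<in> between p" using s(1) by (simp add: between_def ab)
    qed
    ultimately have "card (between q) < card (between p)"
      using fin by (intro psubset_card_mono) auto
    then show False using p(2)[OF q(1)] by simp
  qed
  then show ?thesis using that abW by blast
qed

text \<open>This is the single step that contradicts an extremal choice of the reversal sequence: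
  \<open>W\<close> stays transitive while the sum of squares on \<open>U\<close> grows.\<close>

lemma (in tournament) ex_improving_cycle:
  assumes fin: "finite (pverts G)" and W: "W \<subseteq> pverts G" "trans_on W (parcs G)"
    and U: "U = pverts G - W" "\<not> trans_on U (parcs G)"
    and max: "\<And>x. x \<in> U \<Longrightarrow> \<not> trans_on (insert x W) (parcs G)"
  shows "\<exists>C. dicycle G C \<and> trans_on W (parcs (reverse_cycle G C)) \<and>
    (\<Sum>u\<in>U. (score G U u)\<^sup>2) < (\<Sum>u\<in>U. (score (reverse_cycle G C) U u)\<^sup>2)"
proof -
  have finU: "finite U" and UV: "U \<subseteq> pverts G" using fin U by auto
  obtain x y where xy: "x \<in> U" "y \<in> U" "score G U x = score G U y" "(x, y) \<in> parcs G"
  proof -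
    obtain p q where "p \<in> U" "q \<in> U" "p \<noteq> q" "score G U p = score G U q"
      using inj_score_imp_trans_on[OF finU UV] U(2) unfolding inj_on_def by blast
    then show thesis using that[of p q] that[of q p] arc_total[of p q] UV by auto
  qed
  then have "x \<noteq> y" "(y, x) \<notin> parcs G" using no_loops' arc_asym by auto
  \<comment> \<open>By equality of the scores an inclusion would be an equality, but
    \<open>y\<close> is an out-neighbour of \<open>x\<close> and not of itself.\<close>
  have "\<not> {t \<in> U. (y, t) \<in> parcs G} \<subseteq> {t \<in> U. (x, t) \<in> parcs G}"
  proof
    assume "{t \<in> U. (y, t) \<in> parcs G} \<subseteq> {t \<in> U. (x, t) \<in> parcs G}"
    then have "{t \<in> U. (y, t) \<in> parcs G} = {t \<in> U. (x, t) \<in> parcs G}"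
      using xy(3) finU by (intro card_subset_eq) (auto simp: score_def)
    then show False using xy no_loops' by blast
  qed
  then obtain v where v: "v \<in> U" "(y, v) \<in> parcs G" "(x, v) \<notin> parcs G" by blast
  then have vx: "(v, x) \<in> parcs G" "v \<noteq> x" "v \<noteq> y"
    using arc_total[of x v] xy UV \<open>(y, x) \<notin> parcs G\<close> no_loops' by auto
  have lose: "Suc (card (B - {t})) = card B" if "t \<in> B" "B \<subseteq> U" for B and t :: 'a
    using that finU by (metis card_Suc_Diff1 finite_subset)
  have gain: "card (insert t B) = Suc (card B)" if "t \<notin> B" "B \<subseteq> U" for B and t :: 'a
    using that finU by (meson card_insert_disjoint finite_subset)
  \<comment> \<open>This serves the cycles whose only arc inside \<open>U\<close> is
    \<open>x \<rightarrow> y\<close>: \<open>x\<close> loses that unit of score and \<open>y\<close>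
    gains it.\<close>
  have improve: "(\<Sum>u\<in>U. (score G U u)\<^sup>2) < (\<Sum>u\<in>U. (score (reverse_cycle G C) U u)\<^sup>2)"
    if C: "set C \<inter> U \<times> U = {(x, y)}" for C
  proof (rule sum_squares_increase[OF finU xy(1,2) \<open>x \<noteq> y\<close> xy(3)])
    have arcs: "(s, t) \<in> parcs (reverse_cycle G C) \<longleftrightarrow>
        (s, t) \<in> parcs G \<and> (s, t) \<noteq> (x, y) \<or> (s, t) = (y, x)" if "s \<in> U" "t \<in> U" for s t
      using that C xy(1,2) by (auto simp: reverse_cycle_def)
    have "{t \<in> U. (x, t) \<in> parcs (reverse_cycle G C)} = {t \<in> U. (x, t) \<in> parcs G} - {y}"
      using arcs xy \<open>x \<noteq> y\<close> by auto
    then show "Suc (score (reverse_cycle G C) U x) = score G U x"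
      unfolding score_def using xy lose[of y "{t \<in> U. (x, t) \<in> parcs G}"] by auto
    have "{t \<in> U. (y, t) \<in> parcs (reverse_cycle G C)} = insert x {t \<in> U. (y, t) \<in> parcs G}"
      using arcs xy \<open>x \<noteq> y\<close> by auto
    then show "score (reverse_cycle G C) U y = Suc (score G U y)"
      unfolding score_def using \<open>(y, x) \<notin> parcs G\<close> by (simp add: gain)
    show "score (reverse_cycle G C) U u = score G U u" if "u \<in> U - {x, y}" for u
      unfolding score_def using arcs that by (intro arg_cong[where f = card]) auto
  qed
  have keep: "trans_on W (parcs (reverse_cycle G C))" if "set C \<inter> W \<times> W = {}" for C
  proof -
    have "(s, t) \<in> parcs (reverse_cycle G C) \<longleftrightarrow> (s, t) \<in> parcs G" if "s \<in> W" "t \<in> W" for s t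
      using \<open>set C \<inter> W \<times> W = {}\<close> that by (auto simp: reverse_cycle_def)
    then show ?thesis using W(2) unfolding trans_on_def by metis
  qed
  consider (A) w where "w \<in> W" "(y, w) \<in> parcs G" "(w, x) \<in> parcs G"
    | (B) w where "w \<in> W" "(x, w) \<in> parcs G" "(w, y) \<in> parcs G"
    | (C) "\<And>w. w \<in> W \<Longrightarrow> (x, w) \<in> parcs G \<longleftrightarrow> (y, w) \<in> parcs G"
    using arc_total[of x] arc_total[of y] xy(1,2) U(1) W(1) by blast
  then show ?thesis
  proof cases
    case A
    let ?C = "[(x, y), (y, w), (w, x)]"
    have "w \<notin> U" "x \<notin> W" "y \<notin> W" using A xy U by auto
    then have C: "set ?C \<inter> W \<times> W = {}" "set ?C \<inter> U \<times> U = {(x, y)}" "distinct [x, y, w]"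
      using A(1) xy(1,2) \<open>x \<noteq> y\<close> by auto
    have "{(x, y), (y, w), (w, x)} \<subseteq> parcs G" "{x, y, w} \<subseteq> pverts G"
      using A xy UV W(1) by auto
    then have "dicycle G ?C" using C(3) by (rule cycle_three)
    then show ?thesis using keep[OF C(1)] improve[OF C(2)] by blast
  next
    case B
    \<comment> \<open>The path \<open>x \<rightarrow> w \<rightarrow> y\<close> is closed by the way
      back \<open>y \<rightarrow> v \<rightarrow> x\<close> inside \<open>U\<close>. Two arcs inside
      \<open>U\<close> get reversed, so \<open>improve\<close> does not apply and the scores are
      computed anew.\<close>
    let ?C = "[(y, v), (v, x), (x, w), (w, y)]"
    let ?H = "reverse_cycle G ?C"
    have notin: "w \<notin> U" "x \<notin> W" "y \<notin> W" "v \<notin> W" using B xy v U by auto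
    have arcs: "(s, t) \<in> parcs ?H \<longleftrightarrow>
        (s, t) \<in> parcs G \<and> (s, t) \<noteq> (y, v) \<and> (s, t) \<noteq> (v, x) \<or> (s, t) = (v, y) \<or> (s, t) = (x, v)"
      if "s \<in> U" "t \<in> U" for s t
      using that notin by (auto simp: reverse_cycle_def)
    have less: "(\<Sum>u\<in>U. (score G U u)\<^sup>2) < (\<Sum>u\<in>U. (score ?H U u)\<^sup>2)"
    \<comment> \<open>Now \<open>y\<close> loses a unit and \<open>x\<close> gains one, so their
      roles are swapped.\<close>
    proof (rule sum_squares_increase[OF finU xy(2,1) \<open>x \<noteq> y\<close>[symmetric] xy(3)[symmetric]])
      have "{t \<in> U. (y, t) \<in> parcs ?H} = {t \<in> U. (y, t) \<in> parcs G} - {v}"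
        using arcs xy vx \<open>x \<noteq> y\<close> by auto
      then show "Suc (score ?H U y) = score G U y"
        unfolding score_def using v lose[of v "{t \<in> U. (y, t) \<in> parcs G}"] by auto
      have "{t \<in> U. (x, t) \<in> parcs ?H} = insert v {t \<in> U. (x, t) \<in> parcs G}"
        using arcs xy vx v \<open>x \<noteq> y\<close> by auto
      then show "score ?H U x = Suc (score G U x)"
        unfolding score_def using v by (simp add: gain)
      fix u assume u: "u \<in> U - {y, x}"
      show "score ?H U u = score G U u"
      proof (cases "u = v")
        case True
        \<comment> \<open>The vertex \<open>v\<close> exchanges its out-neighbour \<open>x\<close>
          for \<open>y\<close>, which leaves its score unchanged.\<close>
        have "{t \<in> U. (v, t) \<in> parcs ?H} = insert y ({t \<in> U. (v, t) \<in> parcs G} - {x})"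
          using arcs xy vx v \<open>x \<noteq> y\<close> by auto
        moreover have "(v, y) \<notin> parcs G" using v arc_asym by blast
        ultimately show ?thesis
          unfolding score_def
          using True vx xy(1) lose[of x "{t \<in> U. (v, t) \<in> parcs G}"]
            gain[of y "{t \<in> U. (v, t) \<in> parcs G} - {x}"]
          by auto
      next
        case False
        then show ?thesis
          unfolding score_def using arcs u by (intro arg_cong[where f = card]) auto
      qed
    qed
    have C: "set ?C \<inter> W \<times> W = {}" "distinct [y, v, x, w]"
      using B(1) notin vx(2,3) \<open>x \<noteq> y\<close> by auto
    have "{(y, v), (v, x), (x, w), (w, y)} \<subseteq> parcs G" "{y, v, x, w} \<subseteq> pverts G"
      using B v(1,2) vx(1) xy(1,2) UV W(1) by auto
    then have "dicycle G ?C" using C(2) by (rule cycle_four)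
    then show ?thesis using keep[OF C(1)] less by blast
  next
    case C
    obtain a b where ab: "a \<in> W" "b \<in> W" "(x, a) \<in> parcs G" "(a, b) \<in> parcs G" "(b, x) \<in> parcs G"
      "\<And>t. t \<in> W \<Longrightarrow> (a, t) \<in> parcs G \<Longrightarrow> (t, b) \<notin> parcs G"
      using consecutive_cycle[OF fin W(1) _ W(2) max[OF xy(1)]] xy(1) U(1) by blast
    \<comment> \<open>The arc \<open>y \<rightarrow> a\<close> exists because
      \<open>x \<rightarrow> a\<close> and no vertex of \<open>W\<close> distinguishes
      \<open>x\<close> from \<open>y\<close>. The arc \<open>a \<rightarrow> b\<close> inside
      \<open>W\<close> gets reversed, so \<open>keep\<close> does not apply.\<close>
    let ?C = "[(x, y), (y, a), (a, b), (b, x)]"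
    have notin: "a \<notin> U" "b \<notin> U" "x \<notin> W" "y \<notin> W" "a \<noteq> b" using ab xy U no_loops' by auto
    have arcs: "(s, t) \<in> parcs (reverse_cycle G ?C) \<longleftrightarrow>
        (s, t) \<in> parcs G \<and> (s, t) \<noteq> (a, b) \<or> (s, t) = (b, a)" if "s \<in> W" "t \<in> W" for s t
      using that notin by (auto simp: reverse_cycle_def)
    \<comment> \<open>Being consecutive, \<open>a\<close> and \<open>b\<close> are related in the
      same way to every other vertex of \<open>W\<close>; hence swapping them preserves
      transitivity.\<close>
    have between: "(a, t) \<in> parcs G \<longleftrightarrow> (b, t) \<in> parcs G" "(t, a) \<in> parcs G \<longleftrightarrow> (t, b) \<in> parcs G"
      if "t \<in> W" "t \<noteq> a" "t \<noteq> b" for t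
    proof -
      have "(a, t) \<in> parcs G \<or> (t, a) \<in> parcs G" "(b, t) \<in> parcs G \<or> (t, b) \<in> parcs G"
        using arc_total that ab W(1) by blast+
      moreover have "(a, t) \<in> parcs G" if "(b, t) \<in> parcs G"
        using W(2) ab \<open>t \<in> W\<close> that unfolding trans_on_def by blast
      moreover have "(t, b) \<in> parcs G" if "(t, a) \<in> parcs G"
        using W(2) ab \<open>t \<in> W\<close> that unfolding trans_on_def by blast
      ultimately show "(a, t) \<in> parcs G \<longleftrightarrow> (b, t) \<in> parcs G"
        "(t, a) \<in> parcs G \<longleftrightarrow> (t, b) \<in> parcs G"
        using ab(6)[OF \<open>t \<in> W\<close>] arc_asym by blast+
    qed
    have tr: "trans_on W (parcs (reverse_cycle G ?C))"
    proof (rule trans_onI)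
      fix p q r
      assume W': "p \<in> W" "q \<in> W" "r \<in> W"
        and "(p, q) \<in> parcs (reverse_cycle G ?C)" "(q, r) \<in> parcs (reverse_cycle G ?C)"
      then have "(p, q) \<in> parcs G \<and> (p, q) \<noteq> (a, b) \<or> (p, q) = (b, a)"
        "(q, r) \<in> parcs G \<and> (q, r) \<noteq> (a, b) \<or> (q, r) = (b, a)"
        using arcs by blast+
      moreover have "(p, r) \<in> parcs G" if "(p, q) \<in> parcs G" "(q, r) \<in> parcs G"
        using W(2) W' that unfolding trans_on_def by blast
      ultimately have "(p, r) \<in> parcs G \<and> (p, r) \<noteq> (a, b) \<or> (p, r) = (b, a)"
        using between W' ab no_loops' arc_asym by (metis prod.inject)
      then show "(p, r) \<in> parcs (reverse_cycle G ?C)" using arcs W' by blast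
    qed
    have C': "set ?C \<inter> U \<times> U = {(x, y)}" "distinct [x, y, a, b]"
      using ab(1,2) xy(1,2) notin \<open>x \<noteq> y\<close> by auto
    have "{(x, y), (y, a), (a, b), (b, x)} \<subseteq> parcs G" "{x, y, a, b} \<subseteq> pverts G"
      using ab(1-5) C[OF ab(1)] xy UV W(1) by auto
    then have "dicycle G ?C" using C'(2) by (rule cycle_four)
    then show ?thesis using tr improve[OF C'(1)] by blast
  qed
qed

section \<open>The extremal choice of the sequence and the set\<close>

theorem theorem7p1:
  fixes D :: "'a pair_pre_digraph" and W\<^sub>0 :: "'a set"
  assumes "tournament D" and "finite (pverts D)"
    and "W\<^sub>0 \<subseteq> pverts D" and "induces_acyclic D W\<^sub>0"
  shows "\<exists>W Cs. W\<^sub>0 \<subseteq> W \<and> W \<subseteq> pverts D \<and> Cs \<in> rs D \<and>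
    induces_acyclic (reverse_cycles D Cs) W \<and>
    induces_acyclic (reverse_cycles D Cs) (pverts D - W)"
proof -
  define V where "V = pverts D"
  define P where "P = (\<lambda>(Cs, W). W\<^sub>0 \<subseteq> W \<and> W \<subseteq> V \<and> Cs \<in> rs D \<and>
    trans_on W (parcs (reverse_cycles D Cs)))"
  define size where "size = (\<lambda>(Cs :: ('a \<times> 'a) list list, W :: 'a set). card W)"
  define energy where "energy = (\<lambda>(Cs, W). \<Sum>u\<in>V - W. (score (reverse_cycles D Cs) (V - W) u)\<^sup>2)"
  have fin: "finite V" using assms(2) by (simp add: V_def)
  have "P ([], W\<^sub>0)"
    using assms tournament.induces_acyclic_iff_trans_on[OF assms(1,3)]
    by (simp add: P_def V_def rs_def reverse_cycles_def)
  moreover have "\<forall>p. P p \<longrightarrow> size p < Suc (card V)"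
    using fin by (auto simp: P_def size_def less_Suc_eq_le intro: card_mono)
  ultimately obtain p where p: "P p" "\<And>q. P q \<Longrightarrow> size q \<le> size p"
    using ex_has_greatest_nat[of P _ size] by blast
  \<comment> \<open>There are at most \<open>card V\<close> summands, each at most
    \<open>(card V)\<^sup>2\<close>; this bound guarantees that a maximum exists.\<close>
  have "energy q < Suc (card V * (card V)\<^sup>2)" for q
  proof -
    obtain Cs W where q: "q = (Cs, W)" by fastforce
    have "score (reverse_cycles D Cs) (V - W) u \<le> card V" for u
      unfolding score_def using fin by (intro card_mono) auto
    then have "energy q \<le> (\<Sum>u\<in>V - W. (card V)\<^sup>2)"
      unfolding energy_def q prod.case by (intro sum_mono power_mono) auto
    also have "\<dots> \<le> card V * (card V)\<^sup>2"
      using fin by (simp add: card_mono)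
    finally show ?thesis by simp
  qed
  \<comment> \<open>The maximum is lexicographic: \<open>energy\<close> is compared only among pairs
    of maximal \<open>size\<close>.\<close>
  then obtain q where q: "P q" "size q = size p"
    "\<And>r. P r \<Longrightarrow> size r = size p \<Longrightarrow> energy r \<le> energy q"
    using p(1) ex_has_greatest_nat[of "\<lambda>q. P q \<and> size q = size p" p energy] by blast
  obtain Cs W where CsW: "q = (Cs, W)" by fastforce
  have W: "W\<^sub>0 \<subseteq> W" "W \<subseteq> V" "Cs \<in> rs D" "trans_on W (parcs (reverse_cycles D Cs))"
    using q(1) by (auto simp: P_def CsW)
  interpret E: tournament "reverse_cycles D Cs"
    using tournament_reverse_cycles[OF assms(1) W(3)] .
  have "trans_on (V - W) (parcs (reverse_cycles D Cs))"
  proof (rule ccontr)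
    assume not_trans: "\<not> trans_on (V - W) (parcs (reverse_cycles D Cs))"
    \<comment> \<open>Adding \<open>x\<close> under the same sequence \<open>Cs\<close> would give
      an admissible pair of larger \<open>size\<close>.\<close>
    have "\<not> trans_on (insert x W) (parcs (reverse_cycles D Cs))" if "x \<in> V - W" for x
    proof
      assume "trans_on (insert x W) (parcs (reverse_cycles D Cs))"
      then have "P (Cs, insert x W)" using W that by (auto simp: P_def)
      then have "size (Cs, insert x W) \<le> size q" using p(2) q(2) by simp
      then show False
        using that finite_subset[OF W(2) fin] by (simp add: size_def CsW)
    qed
    then obtain C where C: "dicycle (reverse_cycles D Cs) C"
      "trans_on W (parcs (reverse_cycle (reverse_cycles D Cs) C))"
      "energy q < energy (Cs @ [C], W)"
      using E.ex_improving_cycle[of W "V - W"] W fin not_trans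
      by (auto simp: V_def energy_def CsW reverse_cycles_snoc)
    \<comment> \<open>The set \<open>W\<close> is kept, so the extended sequence gives a pair of the
      same \<open>size\<close> and larger \<open>energy\<close>.\<close>
    then have "P (Cs @ [C], W)" using W by (auto simp: P_def rs_snoc reverse_cycles_snoc)
    then show False using q(2) q(3)[of "(Cs @ [C], W)"] C(3) by (simp add: size_def CsW)
  qed
  then show ?thesis
    using W E.induces_acyclic_iff_trans_on[of W] E.induces_acyclic_iff_trans_on[of "V - W"]
    by (intro exI[of _ W] exI[of _ Cs]) (auto simp: V_def)
qed

end
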